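(* Let $\bm{\theta}:[0,T)\to\mathbb{R}^p$ ($T\in(0,\infty]$) be a solution of the gradient flow $\dot{\bm{\theta}}(t)=-\nabla_{\bm{\theta}}\mathcal{L}(\bm{\theta}(t))=-\bm{g}(\bm{\theta}(t))$, and assume that for every $t\in[0,T)$ at least $C-1$ of the vectors $\{\bm{g}_c(\bm{\theta}(t))-\bm{g}(\bm{\theta}(t))\}_{c=1}^{C}$ are linearly independent. Write $\bm{g}(t)=\bm{g}(\bm{\theta}(t))$, $\bm{G}(t)=\bm{G}(\bm{\theta}(t))$, $\bm{P}(t)=\bm{P}(\bm{\theta}(t))$, $\bm{H}(t)=\bm{H}(\bm{\theta}(t))$, $\bm{H}_c(t)=\bm{H}_c(\bm{\theta}(t))$. Then for every $t\in[0,T)$, $$\|\dot{\bm{P}}(t)\|_F^2\;\le\;\frac{4}{\sigma_{\min}(\bm{G}(t))^2}\left((C-1)\,\|(\bm{I}-\bm{P}(t))\bm{H}(t)\bm{g}(t)\|_2^2+\sum_{c=1}^{C-1}\|(\bm{I}-\bm{P}(t))\bm{H}_c(t)\bm{g}(t)\|_2^2\right).$$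
   Context: Setting. $C\ge 2$ is the number of classes. Training data $\{(\bm{x}_i,y_i)\}_{i=1}^n$ with $\bm{x}_i\in\mathbb{R}^d$, $y_i\in\{1,\dots,C\}$. A model $f(\bm{\theta},\bm{x})\in\mathbb{R}^C$ with parameter $\bm{\theta}\in\mathbb{R}^p$ outputs logits and is twice continuously differentiable in $\bm{\theta}$; $\bm{p}(\bm{\theta},\bm{x})=\mathrm{softmax}(f(\bm{\theta},\bm{x}))$. The per-sample loss is the cross-entropy $\ell(f(\bm{\theta},\bm{x}_i),y_i)=-\log \bm{p}(\bm{\theta},\bm{x}_i)_{y_i}$, and $\mathcal{L}(\bm{\theta})=\frac1n\sum_{i=1}^n\ell(f(\bm{\theta},\bm{x}_i),y_i)$. Class quantities. $\mathcal{I}_c=\{i: y_i=c\}$ and $n_c=|\mathcal{I}_c|\ge 1$ for each $c$. Per-sample gradient $\hat{\bm{g}}_i(\bm{\theta})=\nabla_{\bm{\theta}}\ell(f(\bm{\theta},\bm{x}_i),y_i)$; class gradient $\bm{g}_c(\bm{\theta})=\frac{1}{n_c}\sum_{i\in\mathcal{I}_c}\hat{\bm{g}}_i(\bm{\theta})$; full gradient $\bm{g}(\bm{\theta})=\nabla\mathcal{L}(\bm{\theta})=\sum_{c=1}^C\frac{n_c}{n}\bm{g}_c(\bm{\theta})$. Hessian $\bm{H}(\bm{\theta})=\nabla^2_{\bm{\theta}}\mathcal{L}(\bm{\theta})$; class Hessian $\bm{H}_c(\bm{\theta})=\frac{1}{n_c}\sum_{i\in\mathcal{I}_c}\nabla^2_{\bm{\theta}}\ell(f(\bm{\theta},\bm{x}_i),y_i)$,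 so $\bm{H}=\sum_{c=1}^C\frac{n_c}{n}\bm{H}_c$. $\bm{G}(\bm{\theta})\in\mathbb{R}^{(C-1)\times p}$ is the matrix whose $c$-th row is $(\bm{g}_c(\bm{\theta})-\bm{g}(\bm{\theta}))^\top$, $c=1,\dots,C-1$. (Since $\sum_{c=1}^C\frac{n_c}{n}(\bm{g}_c-\bm{g})=0$ with all $n_c>0$, the independence assumption is equivalent to $\bm{G}$ having full row rank $C-1$.) $\bm{P}(\bm{\theta})=\bm{G}(\bm{\theta})^\top(\bm{G}(\bm{\theta})\bm{G}(\bm{\theta})^\top)^{-1}\bm{G}(\bm{\theta})\in\mathbb{R}^{p\times p}$ is the orthogonal projection onto the row space of $\bm{G}(\bm{\theta})$. $\sigma_{\min}(\bm{G})$ is the smallest of the $C-1$ singular values of $\bm{G}$; $\|\cdot\|_F$ is the Frobenius norm, $\|\cdot\|_2$ the Euclidean norm, and dots denote time derivatives. *)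

theory Defs
  imports "HOL-Analysis.Analysis"
begin

text \<open>
  Classes are the elements of \<^typ>\<open>'k option\<close> with \<^typ>\<open>'k\<close> finite, so the number of classes is
  C = CARD('k option) = CARD('k) + 1, an arbitrary integer at least 2. The classes
  \<^term>\<open>Some k\<close> play the role of 1, ..., C - 1 and \<^term>\<open>None\<close> that of the last class C. Matrices
  with C - 1 rows are thus indexed by \<^typ>\<open>'k\<close>. Samples are numbered 1, ..., n.
\<close>

definition gradient :: "('a::real_inner \<Rightarrow> real) \<Rightarrow> 'a \<Rightarrow> 'a" where
  "gradient F \<theta> = (THE D. GDERIV F \<theta> :> D)"

definition hessian :: "(real^'p \<Rightarrow> real) \<Rightarrow> real^'p \<Rightarrow> real^'p^'p" where
  "hessian F \<theta> = jacobian (gradient F) (at \<theta>)"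

definition twice_continuously_differentiable ::
    "('a::real_normed_vector \<Rightarrow> 'b::real_normed_vector) \<Rightarrow> bool" where
  "twice_continuously_differentiable F \<longleftrightarrow>
     (\<exists>(F' :: 'a \<Rightarrow> 'a \<Rightarrow>\<^sub>L 'b) (F'' :: 'a \<Rightarrow> 'a \<Rightarrow>\<^sub>L ('a \<Rightarrow>\<^sub>L 'b)).
        (\<forall>\<theta>. (F has_derivative blinfun_apply (F' \<theta>)) (at \<theta>)) \<and>
        (\<forall>\<theta>. (F' has_derivative blinfun_apply (F'' \<theta>)) (at \<theta>)) \<and>
        continuous_on UNIV F'')"

definition frobenius_norm :: "real^'n^'m \<Rightarrow> real" where
  "frobenius_norm A = sqrt (\<Sum>i\<in>UNIV. \<Sum>j\<in>UNIV. (A $ i $ j)\<^sup>2)"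

lemma frobenius_norm_eq_norm: "frobenius_norm A = norm A"
  by (simp add: frobenius_norm_def norm_vec_def L2_set_def sum_nonneg)

text \<open>
  The singular values are taken on the row side, as square roots of the eigenvalues of
  \<open>A A\<^sup>T\<close>: an \<open>m \<times> n\<close> matrix has m of them, counted with multiplicity. For \<open>m \<le> n\<close> these are
  the usual \<open>min m n\<close> singular values, zeros included.
\<close>

definition singular_values :: "real^'n^'m \<Rightarrow> real set" where
  "singular_values A =
     {sqrt \<mu> | \<mu>. \<exists>v. v \<noteq> 0 \<and> (A ** transpose A) *v v = \<mu> *s v}"

definition sigma_min :: "real^'n^'m \<Rightarrow> real" where
  "sigma_min A = Min (singular_values A)"

definition softmax :: "real^'c \<Rightarrow> real^'c" where
  "softmax z = (\<chi> c. exp (z $ c) / (\<Sum>j\<in>UNIV. exp (z $ j)))"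

definition cross_entropy :: "real^'c \<Rightarrow> 'c \<Rightarrow> real" where
  "cross_entropy z c = - ln (softmax z $ c)"

definition sample_loss ::
    "(real^'p \<Rightarrow> real^'d \<Rightarrow> real^'c) \<Rightarrow> (nat \<Rightarrow> real^'d) \<Rightarrow> (nat \<Rightarrow> 'c) \<Rightarrow>
     nat \<Rightarrow> real^'p \<Rightarrow> real" where
  "sample_loss f x y i \<theta> = cross_entropy (f \<theta> (x i)) (y i)"

definition total_loss ::
    "(real^'p \<Rightarrow> real^'d \<Rightarrow> real^'c) \<Rightarrow> (nat \<Rightarrow> real^'d) \<Rightarrow> (nat \<Rightarrow> 'c) \<Rightarrow>
     nat \<Rightarrow> real^'p \<Rightarrow> real" where
  "total_loss f x y n \<theta> = (1 / real n) * (\<Sum>i=1..n. sample_loss f x y i \<theta>)"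

definition class_indices :: "(nat \<Rightarrow> 'c) \<Rightarrow> nat \<Rightarrow> 'c \<Rightarrow> nat set" where
  "class_indices y n c = {i \<in> {1..n}. y i = c}"

definition class_gradient ::
    "(real^'p \<Rightarrow> real^'d \<Rightarrow> real^'c) \<Rightarrow> (nat \<Rightarrow> real^'d) \<Rightarrow> (nat \<Rightarrow> 'c) \<Rightarrow>
     nat \<Rightarrow> 'c \<Rightarrow> real^'p \<Rightarrow> real^'p" where
  "class_gradient f x y n c \<theta> =
     (1 / real (card (class_indices y n c))) *\<^sub>R
       (\<Sum>i\<in>class_indices y n c. gradient (sample_loss f x y i) \<theta>)"

definition full_gradient ::
    "(real^'p \<Rightarrow> real^'d \<Rightarrow> real^'c) \<Rightarrow> (nat \<Rightarrow> real^'d) \<Rightarrow> (nat \<Rightarrow> 'c) \<Rightarrow>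
     nat \<Rightarrow> real^'p \<Rightarrow> real^'p" where
  "full_gradient f x y n \<theta> = gradient (total_loss f x y n) \<theta>"

definition class_hessian ::
    "(real^'p \<Rightarrow> real^'d \<Rightarrow> real^'c) \<Rightarrow> (nat \<Rightarrow> real^'d) \<Rightarrow> (nat \<Rightarrow> 'c) \<Rightarrow>
     nat \<Rightarrow> 'c \<Rightarrow> real^'p \<Rightarrow> real^'p^'p" where
  "class_hessian f x y n c \<theta> =
     (1 / real (card (class_indices y n c))) *\<^sub>R
       (\<Sum>i\<in>class_indices y n c. hessian (sample_loss f x y i) \<theta>)"

definition full_hessian ::
    "(real^'p \<Rightarrow> real^'d \<Rightarrow> real^'c) \<Rightarrow> (nat \<Rightarrow> real^'d) \<Rightarrow> (nat \<Rightarrow> 'c) \<Rightarrow>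
     nat \<Rightarrow> real^'p \<Rightarrow> real^'p^'p" where
  "full_hessian f x y n \<theta> = hessian (total_loss f x y n) \<theta>"

definition gradient_deviation ::
    "(real^'p \<Rightarrow> real^'d \<Rightarrow> real^'c) \<Rightarrow> (nat \<Rightarrow> real^'d) \<Rightarrow> (nat \<Rightarrow> 'c) \<Rightarrow>
     nat \<Rightarrow> 'c \<Rightarrow> real^'p \<Rightarrow> real^'p" where
  "gradient_deviation f x y n c \<theta> = class_gradient f x y n c \<theta> - full_gradient f x y n \<theta>"

definition G_mat ::
    "(real^'p \<Rightarrow> real^'d \<Rightarrow> real^('k::finite option)) \<Rightarrow> (nat \<Rightarrow> real^'d) \<Rightarrow> (nat \<Rightarrow> 'k option) \<Rightarrow>
     nat \<Rightarrow> real^'p \<Rightarrow> real^'p^'k" where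
  "G_mat f x y n \<theta> = (\<chi> k. gradient_deviation f x y n (Some k) \<theta>)"

definition P_mat ::
    "(real^'p \<Rightarrow> real^'d \<Rightarrow> real^('k::finite option)) \<Rightarrow> (nat \<Rightarrow> real^'d) \<Rightarrow> (nat \<Rightarrow> 'k option) \<Rightarrow>
     nat \<Rightarrow> real^'p \<Rightarrow> real^'p^'p" where
  "P_mat f x y n \<theta> =
     (let G = G_mat f x y n \<theta>
      in transpose G ** matrix_inv (G ** transpose G) ** G)"

definition lin_indep_family :: "('i \<Rightarrow> 'a::real_vector) \<Rightarrow> 'i set \<Rightarrow> bool" where
  "lin_indep_family v S \<longleftrightarrow> inj_on v S \<and> independent (v ` S)"

text \<open>The interval [0, T); \<open>T = \<infinity>\<close> gives the half line.\<close>

definition time_interval :: "ereal \<Rightarrow> real set" where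
  "time_interval T = {t. 0 \<le> t \<and> ereal t < T}"

text \<open>At t = 0 the derivative is one-sided.\<close>

definition gradient_flow_on :: "real set \<Rightarrow> ('a::real_inner \<Rightarrow> real) \<Rightarrow> (real \<Rightarrow> 'a) \<Rightarrow> bool" where
  "gradient_flow_on I L \<theta> \<longleftrightarrow>
     (\<forall>t\<in>I. (\<theta> has_vector_derivative - gradient L (\<theta> t)) (at t within I))"

end

theory Submission
  imports Defs
begin

text \<open>
  Write \<open>Q = I - P\<close>. Differentiating \<open>P\<^sup>2 = P\<close> gives \<open>P' = PP' + P'P\<close> and \<open>PP'P = 0\<close>, so the two
  summands are Frobenius-orthogonal transposes of each other and \<open>\<parallel>P'\<parallel>\<^sup>2 = 2 \<parallel>P'P\<parallel>\<^sup>2\<close>.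
  Differentiating \<open>PG\<^sup>T = G\<^sup>T\<close> gives \<open>P'G\<^sup>T = QG'\<^sup>T\<close>, hence \<open>P'P = QG'\<^sup>T (GG\<^sup>T)\<^sup>-\<^sup>1 G\<close>, whose rows have norm
  at most those of \<open>QG'\<^sup>T\<close> divided by \<open>\<sigma>\<^sub>m\<^sub>i\<^sub>n(G)\<close>. Along the flow the rows of \<open>G'\<close> are \<open>-(H\<^sub>c - H)g\<close>, and
  \<open>\<parallel>a - b\<parallel>\<^sup>2 \<le> 2\<parallel>a\<parallel>\<^sup>2 + 2\<parallel>b\<parallel>\<^sup>2\<close> gives the remaining factor 2.
\<close>

subsection \<open>Differentiability of the matrix inverse\<close>

lemma matrix_inv_inverse:
  fixes A :: "real^'n^'n"
  assumes "invertible A"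
  shows "A ** matrix_inv A = mat 1" "matrix_inv A ** A = mat 1"
  using someI_ex[of "\<lambda>B. A ** B = mat 1 \<and> B ** A = mat 1"] assms
  unfolding invertible_def matrix_inv_def by auto

section \<open>Matrix product, transpose and the Frobenius inner product\<close>

lemma bounded_bilinear_matrix_matrix_mult:
  "bounded_bilinear ((**) :: real^'n^'m \<Rightarrow> real^'p^'n \<Rightarrow> real^'p^'m)"
  unfolding bilinear_conv_bounded_bilinear[symmetric] bilinear_def
  by (auto intro!: linearI simp: matrix_matrix_mult_def vec_eq_iff distrib_left distrib_right
      sum.distrib sum_distrib_left mult.assoc mult.left_commute)

lemma bounded_linear_transpose:
  "bounded_linear (transpose :: real^'n^'m \<Rightarrow> real^'m^'n)"
  unfolding linear_conv_bounded_linear[symmetric]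
  by (auto intro!: linearI simp: transpose_def vec_eq_iff)

lemma norm_transpose: "norm (transpose A) = norm (A :: real^'n^'m)"
  unfolding frobenius_norm_eq_norm[symmetric] frobenius_norm_def
  by (subst sum.swap) (simp add: transpose_def)

lemma norm_matrix_squared_rows: "(norm (A :: real^'n^'m))\<^sup>2 = (\<Sum>i\<in>UNIV. (norm (A $ i))\<^sup>2)"
  by (simp add: norm_vec_def L2_set_def sum_nonneg)

text \<open>For the Frobenius inner product, right multiplication by \<open>B\<close> has right
  multiplication by its transpose as adjoint. Used with a symmetric projection for
  \<open>B\<close>.\<close>

lemma inner_matrix_mult_right:
  fixes A :: "real^'n^'m" and B :: "real^'p^'n" and C :: "real^'p^'m"
  shows "(A ** B) \<bullet> C = A \<bullet> (C ** transpose B)"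
  unfolding inner_vec_def matrix_matrix_mult_def transpose_def
  by (simp add: sum_distrib_left sum_distrib_right) (rule sum.cong, simp, subst sum.swap, simp add: mult_ac)

lemma inner_transpose: "transpose A \<bullet> transpose B = A \<bullet> (B :: real^'n^'m)"
  unfolding inner_vec_def transpose_def by (simp, subst sum.swap) simp

section \<open>Differentiability of determinants and of inverses\<close>

lemma differentiable_real_prod:
  fixes f :: "'i \<Rightarrow> 'a::real_normed_vector \<Rightarrow> real"
  assumes "\<And>i. i \<in> I \<Longrightarrow> f i differentiable (at x within S)"
  shows "(\<lambda>x. \<Prod>i\<in>I. f i x) differentiable (at x within S)"
proof -
  have "\<forall>i\<in>I. \<exists>f'. (f i has_derivative f') (at x within S)"
    using assms unfolding differentiable_def by blast
  from bchoice[OF this] obtain f' where "\<forall>i\<in>I. (f i has_derivative f' i) (at x within S)" by blast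
  then show ?thesis
    by (intro differentiableI[OF has_derivative_prod]) blast
qed

lemma differentiable_vec_iff:
  fixes f :: "'a::real_normed_vector \<Rightarrow> ('b::euclidean_space)^'n"
  shows "f differentiable (at x within S) \<longleftrightarrow> (\<forall>i. (\<lambda>x. f x $ i) differentiable (at x within S))"
  by (subst (1 2) differentiable_componentwise_within) (auto simp: Basis_vec_def inner_axis)

lemma differentiable_det:
  fixes A :: "'a::real_normed_vector \<Rightarrow> real^'n^'n"
  assumes "A differentiable (at x within S)"
  shows "(\<lambda>x. det (A x)) differentiable (at x within S)"
  using assms unfolding det_def
  by (auto simp: differentiable_vec_iff intro!: differentiable_sum differentiable_mult differentiable_real_prod)

text \<open>Column \<open>j\<close> of the inverse solves \<open>A z = axis j 1\<close>, so Cramer's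
  rule gives its entries. As quotients of determinants they are visibly differentiable in
  \<open>A\<close>.\<close>

lemma matrix_inv_cramer:
  fixes A :: "real^'n^'n"
  assumes "invertible A"
  shows "matrix_inv A $ k $ j = det (\<chi> i l. if l = k then axis j 1 $ i else A $ i $ l) / det A"
proof -
  have "A *v (matrix_inv A *v axis j 1) = axis j 1"
    by (simp add: matrix_vector_mul_assoc matrix_inv_inverse assms)
  then have "matrix_inv A *v axis j 1 = (\<chi> k. det (\<chi> i l. if l = k then axis j 1 $ i else A $ i $ l) / det A)"
    using cramer[of A "matrix_inv A *v axis j 1" "axis j 1"] assms by (simp add: invertible_det_nz)
  then show ?thesis
    by (metis (lifting) column_def matrix_vector_mul_component matrix_vector_mult_basis vec_lambda_beta)
qed

lemma differentiable_matrix_inv: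
  fixes A :: "'a::real_normed_vector \<Rightarrow> real^'n^'n"
  assumes A: "A differentiable (at x within S)" and "x \<in> S" and inv: "\<And>s. s \<in> S \<Longrightarrow> invertible (A s)"
  shows "(\<lambda>s. matrix_inv (A s)) differentiable (at x within S)"
proof -
  have entry: "(\<lambda>s. if l = k then axis j 1 $ i else A s $ i $ l) differentiable (at x within S)" for i j k l
    using A by (cases "l = k") (simp_all add: differentiable_vec_iff)
  have "(\<lambda>s. matrix_inv (A s) $ k $ j) differentiable (at x within S)" for k j
  \<comment> \<open>Invertibility is known only on \<open>S\<close>, so Cramer's formula replaces
    the entry only within \<open>S\<close>; the radius 1 is arbitrary.\<close>
  proof (rule differentiable_transform_within[OF _ zero_less_one \<open>x \<in> S\<close>])
    show "(\<lambda>s. det (\<chi> i l. if l = k then axis j 1 $ i else A s $ i $ l) / det (A s)) differentiable (at x within S)"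
    proof (intro differentiable_divide differentiable_det A)
      show "(\<lambda>s. \<chi> i l. if l = k then axis j 1 $ i else A s $ i $ l) differentiable (at x within S)"
        unfolding differentiable_vec_iff using entry by simp
      show "det (A x) \<noteq> 0" using inv[OF \<open>x \<in> S\<close>] by (simp add: invertible_det_nz)
    qed
  qed (simp add: matrix_inv_cramer inv)
  then show ?thesis by (simp add: differentiable_vec_iff)
qed

subsection \<open>The smallest singular value\<close>

text \<open>The one identity from which both the symmetry and the positive semidefiniteness of the
  Gram matrix are read off.\<close>

lemma inner_gram_matrix:
  fixes A :: "real^'n^'m"
  shows "v \<bullet> ((A ** transpose A) *v w) = (transpose A *v v) \<bullet> (transpose A *v w)"
  by (metis dot_lmul_matrix matrix_vector_mul_assoc transpose_matrix_vector)

text \<open>Eigenvectors of distinct eigenvalues are orthogonal, hence independent, so there are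
  only finitely many. Finiteness is what makes the \<open>Min\<close> in \<open>sigma_min\<close> a
  true minimum.\<close>

lemma finite_eigenvalues_symmetric:
  fixes M :: "real^'n^'n"
  assumes sym: "\<And>v w. v \<bullet> (M *v w) = (M *v v) \<bullet> w"
  shows "finite {\<mu>. \<exists>v. v \<noteq> 0 \<and> M *v v = \<mu> *s v}" (is "finite ?E")
proof -
  define e where "e \<mu> = (SOME v. v \<noteq> 0 \<and> M *v v = \<mu> *s v)" for \<mu>
  have e: "e \<mu> \<noteq> 0 \<and> M *v e \<mu> = \<mu> *s e \<mu>" if "\<mu> \<in> ?E" for \<mu>
    unfolding e_def by (rule someI_ex) (use that in simp)
  have orth: "e \<mu> \<bullet> e \<nu> = 0" if "\<mu> \<in> ?E" "\<nu> \<in> ?E" "\<mu> \<noteq> \<nu>" for \<mu> \<nu>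
  proof -
    have "\<nu> * (e \<mu> \<bullet> e \<nu>) = \<mu> * (e \<mu> \<bullet> e \<nu>)"
      using sym[of "e \<mu>" "e \<nu>"] e[OF that(1)] e[OF that(2)]
      by (simp add: scalar_mult_eq_scaleR)
    then show ?thesis using that(3) by simp
  qed
  \<comment> \<open>A vector shared by two eigenvalues would be orthogonal to itself, hence
    zero.\<close>
  have "inj_on e ?E"
  proof (rule inj_onI, rule ccontr)
    fix \<mu> \<nu> assume "\<mu> \<in> ?E" "\<nu> \<in> ?E" "e \<mu> = e \<nu>" "\<mu> \<noteq> \<nu>"
    then show False using orth[of \<mu> \<nu>] e[of \<nu>] by simp
  qed
  moreover have "independent (e ` ?E)"
  proof (rule pairwise_orthogonal_independent)
    show "pairwise orthogonal (e ` ?E)"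
      unfolding pairwise_image orthogonal_def using orth by (auto simp: pairwise_def)
    show "0 \<notin> e ` ?E" using e by (metis (no_types, lifting) imageE)
  qed
  ultimately show ?thesis
    using independent_imp_finite finite_image_iff by blast
qed

text \<open>Such a \<open>v\<close> minimises the quadratic form, so the form cannot decrease along
  \<open>- M v\<close>; to first order it would, unless \<open>M v = 0\<close>. This turns a
  minimiser of the Rayleigh quotient into an eigenvector.\<close>

lemma psd_null_vector:
  fixes M :: "real^'n^'n"
  assumes sym: "\<And>v w. v \<bullet> (M *v w) = (M *v v) \<bullet> w"
    and psd: "\<And>w. 0 \<le> w \<bullet> (M *v w)" and v: "v \<bullet> (M *v v) = 0"
  shows "M *v v = 0"
proof -
  define u where "u = M *v v"
  define a where "a = u \<bullet> u"
  define b where "b = u \<bullet> (M *v u)"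
  \<comment> \<open>Any small positive step works: the form is \<open>s\<^sup>2 b - 2 s a\<close> at \<open>v - s u\<close>; the 1 covers \<open>b = 0\<close>.\<close>
  define s where "s = a / (b + 1)"
  have b: "b \<ge> 0" unfolding b_def by (rule psd)
  have "M *v (v - s *\<^sub>R u) = u - s *\<^sub>R (M *v u)"
    by (simp add: u_def matrix_vector_mult_diff_distrib matrix_vector_mult_scaleR)
  moreover have "v \<bullet> u = 0" using v by (simp add: u_def)
  moreover have "v \<bullet> (M *v u) = a" using sym[of v u] by (simp add: u_def a_def)
  ultimately have "(v - s *\<^sub>R u) \<bullet> (M *v (v - s *\<^sub>R u)) = - 2 * s * a + s\<^sup>2 * b"
    by (simp add: inner_diff_left inner_diff_right b_def power2_eq_square algebra_simps flip: a_def)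
  then have "0 \<le> - 2 * s * a + s\<^sup>2 * b" using psd by metis
  moreover have "a = s * (b + 1)" using b by (simp add: s_def)
  ultimately have "0 \<le> - (s\<^sup>2 * (b + 2))" by (simp add: algebra_simps power2_eq_square)
  then have "s\<^sup>2 * (b + 2) \<le> 0" by simp
  then have "s = 0" using b by (simp add: mult_le_0_iff)
  then show ?thesis using \<open>a = s * (b + 1)\<close> by (simp add: a_def u_def)
qed

text \<open>The witness is the minimum of the Rayleigh quotient of \<open>A A\<^sup>T\<close> over the unit sphere.\<close>

lemma least_singular_value:
  fixes A :: "real^'n^'m"
  obtains \<mu> where "sqrt \<mu> \<in> singular_values A"
    "\<And>w. \<mu> * (norm w)\<^sup>2 \<le> (norm (transpose A *v w))\<^sup>2"
proof -
  let ?\<phi> = "\<lambda>w. (norm (transpose A *v w))\<^sup>2"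
  have "continuous_on (sphere 0 1) ?\<phi>"
    by (intro continuous_intros linear_continuous_on)
  moreover have "sphere (0::real^'m) 1 \<noteq> {}" by simp
  ultimately obtain v where v: "norm v = 1" and min: "\<And>w. norm w = 1 \<Longrightarrow> ?\<phi> v \<le> ?\<phi> w"
    using continuous_attains_inf[OF compact_sphere, of 0 1 ?\<phi>] by (metis mem_sphere_0)
  define \<mu> where "\<mu> = ?\<phi> v"
  have rayleigh: "\<mu> * (norm w)\<^sup>2 \<le> ?\<phi> w" for w
  proof (cases "w = 0")
    case False
    have "\<mu> \<le> ?\<phi> ((1 / norm w) *\<^sub>R w)"
      unfolding \<mu>_def by (rule min) (use False in simp)
    also have "\<dots> = ?\<phi> w / (norm w)\<^sup>2"
      by (simp add: matrix_vector_mult_scaleR power_divide)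
    finally show ?thesis using False by (simp add: field_simps)
  qed simp
  let ?M = "A ** transpose A"
  have M: "(?M - \<mu> *\<^sub>R mat 1) *v w = ?M *v w - \<mu> *\<^sub>R w" for w
    by (simp add: matrix_vector_mult_diff_rdistrib flip: scaleR_matrix_vector_assoc)
  have sym: "v \<bullet> (?M *v w) = (?M *v v) \<bullet> w" for v w
    by (metis inner_commute inner_gram_matrix)
  \<comment> \<open>The Rayleigh bound says that the shifted Gram matrix is positive semidefinite,
    and its form vanishes at the minimiser \<open>v\<close>.\<close>
  have "(?M - \<mu> *\<^sub>R mat 1) *v v = 0"
  proof (rule psd_null_vector)
    show "v \<bullet> ((?M - \<mu> *\<^sub>R mat 1) *v w) = ((?M - \<mu> *\<^sub>R mat 1) *v v) \<bullet> w" for v w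
      by (simp add: M inner_diff_left inner_diff_right sym)
    show "0 \<le> w \<bullet> ((?M - \<mu> *\<^sub>R mat 1) *v w)" for w
      using rayleigh[of w] by (simp add: M inner_diff_right inner_gram_matrix power2_norm_eq_inner)
    show "v \<bullet> ((?M - \<mu> *\<^sub>R mat 1) *v v) = 0"
      using v by (simp add: M inner_diff_right inner_gram_matrix) (simp add: \<mu>_def power2_norm_eq_inner norm_eq_1)
  qed
  then have "?M *v v = \<mu> *s v" by (simp add: M scalar_mult_eq_scaleR)
  moreover have "v \<noteq> 0" using v by auto
  ultimately have "sqrt \<mu> \<in> singular_values A" unfolding singular_values_def by blast
  then show thesis using rayleigh that by blast
qed

lemma finite_singular_values: "finite (singular_values A)"
proof -
  have "singular_values A = sqrt ` {\<mu>. \<exists>v. v \<noteq> 0 \<and> (A ** transpose A) *v v = \<mu> *s v}"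
    unfolding singular_values_def by auto
  also have "finite \<dots>"
    by (intro finite_imageI finite_eigenvalues_symmetric) (metis inner_commute inner_gram_matrix)
  finally show ?thesis .
qed

text \<open>Invertibility makes \<open>A^T\<close> injective, so all eigenvalues of the Gram matrix
  are positive. The Rayleigh minimum is one of them, hence at least the square of
  \<open>sigma_min A\<close>.\<close>

lemma sigma_min_lower_bound:
  fixes A :: "real^'n^'m"
  assumes "invertible (A ** transpose A)"
  shows sigma_min_pos: "0 < sigma_min A"
    and sigma_min_bound: "(sigma_min A)\<^sup>2 * (norm w)\<^sup>2 \<le> (norm (transpose A *v w))\<^sup>2"
proof -
  have pos: "0 < \<mu>" if v: "v \<noteq> 0" "(A ** transpose A) *v v = \<mu> *s v" for \<mu> v
  proof -
    have "\<mu> * (norm v)\<^sup>2 = (norm (transpose A *v v))\<^sup>2"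
      using inner_gram_matrix[of v A v] v(2) by (simp add: scalar_mult_eq_scaleR power2_norm_eq_inner)
    moreover have "transpose A *v v \<noteq> 0"
    proof
      assume "transpose A *v v = 0"
      then have "(A ** transpose A) *v v = 0" by (simp flip: matrix_vector_mul_assoc)
      then have "matrix_inv (A ** transpose A) *v ((A ** transpose A) *v v) = 0" by simp
      then show False using v(1) by (simp add: matrix_vector_mul_assoc matrix_inv_inverse(2)[OF assms])
    qed
    ultimately have "0 < \<mu> * (norm v)\<^sup>2" by simp
    then show ?thesis by (simp add: zero_less_mult_iff)
  qed
  obtain \<mu> where \<mu>: "sqrt \<mu> \<in> singular_values A"
    "\<And>w. \<mu> * (norm w)\<^sup>2 \<le> (norm (transpose A *v w))\<^sup>2"
    using least_singular_value[of A] by blast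
  have "sigma_min A \<in> singular_values A"
    unfolding sigma_min_def using \<mu>(1) by (intro Min_in finite_singular_values) auto
  then show s: "0 < sigma_min A" using pos unfolding singular_values_def by auto
  have "sigma_min A \<le> sqrt \<mu>"
    unfolding sigma_min_def using \<mu>(1) by (intro Min_le finite_singular_values)
  then have "(sigma_min A)\<^sup>2 \<le> \<mu>"
    by (metis s less_eq_real_def power_mono real_sqrt_gt_0_iff real_sqrt_pow2 order_less_le_trans)
  then show "(sigma_min A)\<^sup>2 * (norm w)\<^sup>2 \<le> (norm (transpose A *v w))\<^sup>2"
    using \<mu>(2)[of w] by (meson mult_right_mono order_trans zero_le_power2)
qed

text \<open>The right inverse \<open>A^T (A A^T)^-1\<close> has operator norm at most
  \<open>1 / sigma_min A\<close>. With \<open>w = (A A^T)^-1 a\<close> the squared norm is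
  \<open>w \<bullet> a\<close>; Cauchy-Schwarz and the lower bound on \<open>A^T w\<close> give
  \<open>norm w \<le> norm a / sigma_min^2\<close>.\<close>

lemma inverse_gram_bound:
  fixes A :: "real^'n^'m"
  assumes inv: "invertible (A ** transpose A)"
  shows "(norm (transpose A *v (matrix_inv (A ** transpose A) *v a)))\<^sup>2 \<le> (norm a)\<^sup>2 / (sigma_min A)\<^sup>2"
proof -
  define w where "w = matrix_inv (A ** transpose A) *v a"
  have a: "(A ** transpose A) *v w = a"
    by (simp add: w_def matrix_vector_mul_assoc matrix_inv_inverse(1)[OF inv])
  have eq: "(norm (transpose A *v w))\<^sup>2 = w \<bullet> a"
    by (metis a inner_gram_matrix power2_norm_eq_inner)
  note s = sigma_min_pos[OF inv]
  have le: "w \<bullet> a \<le> norm w * norm a" by (rule norm_cauchy_schwarz)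
  have "(sigma_min A)\<^sup>2 * (norm w)\<^sup>2 \<le> norm w * norm a"
    using sigma_min_bound[OF inv, of w] le eq by linarith
  then have "(sigma_min A)\<^sup>2 * norm w \<le> norm a"
    by (cases "w = 0") (simp_all add: power2_eq_square)
  then have "norm w \<le> norm a / (sigma_min A)\<^sup>2" using s by (simp add: field_simps)
  then have "norm w * norm a \<le> norm a / (sigma_min A)\<^sup>2 * norm a" by (rule mult_right_mono) simp
  then show ?thesis using eq le unfolding w_def[symmetric] by (simp add: power2_eq_square)
qed

subsection \<open>Derivative of a row-space projection\<close>

lemmas has_vector_derivative_matrix_mult =
  bounded_bilinear.has_vector_derivative[OF bounded_bilinear_matrix_matrix_mult]

lemmas matrix_add_rdistrib = bounded_bilinear.add_left[OF bounded_bilinear_matrix_matrix_mult]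
lemmas matrix_diff_rdistrib = bounded_bilinear.diff_left[OF bounded_bilinear_matrix_matrix_mult]

lemma transpose_zero: "transpose (0 :: real^'n^'m) = 0"
  by (simp add: transpose_def vec_eq_iff)

text \<open>The columns of the product are \<open>Q\<close> applied to the rows of \<open>B\<close>;
  this turns the Frobenius norm into a sum over classes.\<close>

lemma norm_matrix_transpose_mult_squared:
  fixes Q :: "real^'n^'n" and B :: "real^'n^'m"
  shows "(norm (Q ** transpose B))\<^sup>2 = (\<Sum>k\<in>UNIV. (norm (Q *v (B $ k)))\<^sup>2)"
proof -
  have "transpose (Q ** transpose B) $ k = Q *v (B $ k)" for k
    by (simp add: vec_eq_iff transpose_def matrix_matrix_mult_def matrix_vector_mult_def)
  then show ?thesis
    using norm_matrix_squared_rows[of "transpose (Q ** transpose B)"] by (simp add: norm_transpose)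
qed

lemma row_matrix_mult: "(A ** B) $ i = transpose B *v (A $ i)" for A :: "real^'n^'m"
  by (simp add: vec_eq_iff transpose_def matrix_matrix_mult_def matrix_vector_mult_def mult.commute)

text \<open>Collects the algebraic identities at a single time; holding at every time of the
  interval, they can be differentiated.\<close>

locale row_space_projection =
  fixes G :: "real^'n^'m" and P :: "real^'n^'n"
  assumes invertible_gram: "invertible (G ** transpose G)"
    and P_eq: "P = transpose G ** matrix_inv (G ** transpose G) ** G"
begin

lemma transpose_gram_inverse: "transpose (matrix_inv (G ** transpose G)) = matrix_inv (G ** transpose G)"
proof -
  let ?M = "G ** transpose G" and ?N = "matrix_inv (G ** transpose G)"
  have M: "transpose ?M = ?M" by (simp add: matrix_transpose_mul)
  have "transpose ?N ** ?M = mat 1"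
    by (metis M invertible_gram matrix_inv_inverse(1) matrix_transpose_mul transpose_mat)
  then show ?thesis
    by (metis invertible_gram matrix_inv_inverse(1) matrix_mul_assoc matrix_mul_lid matrix_mul_rid)
qed

lemma transpose_P: "transpose P = P"
  unfolding P_eq by (simp add: matrix_transpose_mul transpose_gram_inverse matrix_mul_assoc)

lemma P_mult_transpose: "P ** transpose G = transpose G"
  unfolding P_eq by (metis invertible_gram matrix_inv_inverse(2) matrix_mul_assoc matrix_mul_rid)

lemma P_idem: "P ** P = P"
  by (metis P_eq P_mult_transpose matrix_mul_assoc)

end

text \<open>Stated for any curve of matrices with invertible Gram matrix. The condition on
  \<open>at t within I\<close> makes derivatives unique, and it allows an endpoint of the
  interval.\<close>

lemma projection_derivative_bound:
  fixes G :: "real \<Rightarrow> real^'n^'m"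
  defines "P \<equiv> \<lambda>s. transpose (G s) ** matrix_inv (G s ** transpose (G s)) ** G s"
  assumes t: "t \<in> I" "at t within I \<noteq> bot"
    and inv: "\<And>s. s \<in> I \<Longrightarrow> invertible (G s ** transpose (G s))"
    and G': "(G has_vector_derivative G') (at t within I)"
  shows "P differentiable (at t within I)"
    and "(norm (vector_derivative P (at t within I)))\<^sup>2 \<le>
      2 / (sigma_min (G t))\<^sup>2 * (\<Sum>k\<in>UNIV. (norm ((mat 1 - P t) *v (G' $ k)))\<^sup>2)"
proof -
  have proj: "row_space_projection (G s) (P s)" if "s \<in> I" for s
    unfolding row_space_projection_def P_def using inv[OF that] by simp
  interpret row_space_projection "G t" "P t" using proj[OF t(1)] .
  have GT': "((\<lambda>s. transpose (G s)) has_vector_derivative transpose G') (at t within I)"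
    by (rule bounded_linear.has_vector_derivative[OF bounded_linear_transpose G'])
  have "(\<lambda>s. matrix_inv (G s ** transpose (G s))) differentiable (at t within I)"
    by (rule differentiable_matrix_inv[OF
      differentiableI_vector[OF has_vector_derivative_matrix_mult[OF G' GT']] t(1) inv])
  then obtain N' where
    N': "((\<lambda>s. matrix_inv (G s ** transpose (G s))) has_vector_derivative N') (at t within I)"
    using vector_derivative_works by blast
  show diff: "P differentiable (at t within I)"
    unfolding P_def
    by (rule differentiableI_vector)
       (rule has_vector_derivative_matrix_mult[OF has_vector_derivative_matrix_mult[OF GT' N'] G'])
  define P' where "P' = vector_derivative P (at t within I)"
  have P': "(P has_vector_derivative P') (at t within I)"
    unfolding P'_def using diff vector_derivative_works by blast
  \<comment> \<open>Functions equal on \<open>I\<close> have equal derivatives within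
    \<open>I\<close>: the device by which each identity of the locale is differentiated.\<close>
  have unique: "A = B"
    if "(f has_vector_derivative A) (at t within I)" "(g has_vector_derivative B) (at t within I)"
      "\<And>s. s \<in> I \<Longrightarrow> f s = g s" for A B and f g :: "real \<Rightarrow> real^'a^'b"
    using that t by (metis has_vector_derivative_transform vector_derivative_unique_within)
  have idem': "P t ** P' + P' ** P t = P'"
    by (rule unique[OF has_vector_derivative_matrix_mult[OF P' P'] P'])
      (rule row_space_projection.P_idem[OF proj])
  have range': "P t ** transpose G' + P' ** transpose (G t) = transpose G'"
    by (rule unique[OF has_vector_derivative_matrix_mult[OF P' GT'] GT'])
      (rule row_space_projection.P_mult_transpose[OF proj])
  have sym': "transpose P' = P'"
    by (rule unique[OF bounded_linear.has_vector_derivative[OF bounded_linear_transpose P'] P'])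
      (rule row_space_projection.transpose_P[OF proj])

  define D where "D = P' ** P t"
  have D_t: "transpose D = P t ** P'" by (simp add: D_def matrix_transpose_mul transpose_P sym')
  \<comment> \<open>Multiplying \<open>idem'\<close> by \<open>P t\<close> on the right gives
    \<open>P P' P = 0\<close>.\<close>
  have "P t ** D + D = D"
    using arg_cong[OF idem', of "\<lambda>X. X ** P t"]
    by (simp add: D_def matrix_mul_assoc[symmetric] P_idem matrix_add_rdistrib)
  then have "P t ** D = 0" by simp
  then have "transpose D ** P t = 0" by (metis matrix_transpose_mul transpose_P transpose_zero)
  moreover have "D ** P t = D" by (simp add: D_def matrix_mul_assoc[symmetric] P_idem)
  \<comment> \<open>Since \<open>D = D P\<close>, moving \<open>P\<close> to the other factor leaves
    \<open>D^T P\<close>, which is zero.\<close>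
  ultimately have "D \<bullet> transpose D = 0"
    using inner_matrix_mult_right[of D "P t" "transpose D"] by (simp add: transpose_P)
  moreover have "P' = transpose D + D" unfolding D_t using idem' by (simp add: D_def)
  ultimately have norm_P': "(norm P')\<^sup>2 = 2 * (norm D)\<^sup>2"
    by (simp add: power2_norm_eq_inner inner_add_left inner_add_right inner_transpose inner_commute)

  define Q where "Q = mat 1 - P t"
  define A where "A = Q ** transpose G'"
  have "P' ** transpose (G t) = A"
    using range' by (simp add: A_def Q_def matrix_diff_rdistrib eq_diff_eq add.commute)
  then have D: "D = A ** (matrix_inv (G t ** transpose (G t)) ** G t)"
    by (simp add: D_def P_def matrix_mul_assoc)
  \<comment> \<open>As the inverse Gram matrix is symmetric, row \<open>i\<close> of
    \<open>D\<close> is the right inverse of \<open>G t\<close> applied to row \<open>i\<close> of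
    \<open>A\<close>.\<close>
  have "(norm (D $ i))\<^sup>2 \<le> (norm (A $ i))\<^sup>2 / (sigma_min (G t))\<^sup>2" for i
    using inverse_gram_bound[OF inv[OF t(1)], of "A $ i"]
    by (simp add: D row_matrix_mult matrix_transpose_mul transpose_gram_inverse matrix_vector_mul_assoc)
  then have "(norm D)\<^sup>2 \<le> (norm A)\<^sup>2 / (sigma_min (G t))\<^sup>2"
    unfolding norm_matrix_squared_rows sum_divide_distrib by (intro sum_mono) auto
  then have "(norm P')\<^sup>2 \<le> 2 / (sigma_min (G t))\<^sup>2 * (norm A)\<^sup>2"
    using norm_P' by simp
  then show "(norm (vector_derivative P (at t within I)))\<^sup>2 \<le>
      2 / (sigma_min (G t))\<^sup>2 * (\<Sum>k\<in>UNIV. (norm ((mat 1 - P t) *v (G' $ k)))\<^sup>2)"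
    by (simp add: A_def Q_def norm_matrix_transpose_mult_squared P'_def)
qed

subsection \<open>Gradients of the cross-entropy loss\<close>

lemma gradient_eqI:
  assumes "GDERIV F \<theta> :> D"
  shows "gradient F \<theta> = D"
  unfolding gradient_def
proof (rule the_equality)
  fix D' assume "GDERIV F \<theta> :> D'"
  then have "(\<lambda>h. h \<bullet> D') = (\<lambda>h. h \<bullet> D)"
    using assms has_derivative_unique unfolding gderiv_def by blast
  then show "D' = D" by (simp add: fun_eq_iff vector_eq_ldot)
qed (rule assms)

lemma hessian_works:
  assumes "gradient F differentiable (at \<theta>)"
  shows "(gradient F has_derivative (\<lambda>h. hessian F \<theta> *v h)) (at \<theta>)"
  using assms jacobian_works unfolding hessian_def by blast

lemma sum_exp_pos: "0 < (\<Sum>j\<in>UNIV. exp ((z :: real^'c) $ j))"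
  by (intro sum_pos) auto

lemma cross_entropy_eq: "cross_entropy z c = ln (\<Sum>j\<in>UNIV. exp (z $ j)) - z $ c"
  unfolding cross_entropy_def softmax_def using sum_exp_pos[of z] by (simp add: ln_div)

text \<open>The gradient of log-sum-exp is the softmax, so the derivative in the logits is softmax
  minus the indicator of \<open>c\<close>; the chain rule inserts \<open>F'\<close>.\<close>

lemma has_derivative_cross_entropy:
  assumes F: "(F has_derivative F') (at \<theta> within S)"
  shows "((\<lambda>\<eta>. cross_entropy (F \<eta>) c) has_derivative
    (\<lambda>h. (\<Sum>j\<in>UNIV. softmax (F \<theta>) $ j * F' h $ j) - F' h $ c)) (at \<theta> within S)"
proof -
  show ?thesis
    unfolding cross_entropy_eq softmax_def using sum_exp_pos[of "F \<theta>"]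
    by (auto intro!: derivative_eq_intros bounded_linear.has_derivative[OF bounded_linear_vec_nth F]
        simp: sum_divide_distrib sum_distrib_left field_simps)
qed

text \<open>The first derivative is built by sums and products from the softmax of \<open>F\<close>
  and from \<open>F'\<close>, both differentiable in the parameter.\<close>

lemma cross_entropy_gradient:
  fixes F :: "real^'p \<Rightarrow> real^'c"
  assumes "twice_continuously_differentiable F"
  shows GDERIV_cross_entropy: "GDERIV (\<lambda>\<eta>. cross_entropy (F \<eta>) c) \<theta> :> gradient (\<lambda>\<eta>. cross_entropy (F \<eta>) c) \<theta>"
    and differentiable_gradient_cross_entropy: "gradient (\<lambda>\<eta>. cross_entropy (F \<eta>) c) differentiable (at \<theta>)"
proof -
  obtain F' :: "real^'p \<Rightarrow> (real^'p) \<Rightarrow>\<^sub>L (real^'c)" and F'' where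
    F': "\<And>\<theta>. (F has_derivative blinfun_apply (F' \<theta>)) (at \<theta>)" and
    F'': "\<And>\<theta>. (F' has_derivative blinfun_apply (F'' \<theta>)) (at \<theta>)"
    using assms unfolding twice_continuously_differentiable_def by blast
  define D where "D = (\<lambda>\<theta> h. (\<Sum>j\<in>UNIV. softmax (F \<theta>) $ j * blinfun_apply (F' \<theta>) h $ j) - blinfun_apply (F' \<theta>) h $ c)"
  \<comment> \<open>The vector representing the functional \<open>D \<theta>\<close>, read off on
    the standard basis.\<close>
  define g where "g = (\<lambda>\<theta>. \<chi> i. D \<theta> (axis i 1))"
  have D: "((\<lambda>\<eta>. cross_entropy (F \<eta>) c) has_derivative D \<theta>) (at \<theta>)" for \<theta>
    unfolding D_def by (rule has_derivative_cross_entropy[OF F'])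
  have D_inner: "D \<theta> h = h \<bullet> g \<theta>" for \<theta> h
  proof -
    have "linear (D \<theta>)" using D has_derivative_linear by blast
    then have "D \<theta> (\<Sum>i\<in>UNIV. h $ i *\<^sub>R axis i 1) = (\<Sum>i\<in>UNIV. h $ i *\<^sub>R D \<theta> (axis i 1))"
      by (simp add: linear_sum linear_scale)
    then show ?thesis
      using basis_expansion[of h] by (simp add: scalar_mult_eq_scaleR inner_vec_def g_def)
  qed
  have g: "GDERIV (\<lambda>\<eta>. cross_entropy (F \<eta>) c) \<theta> :> g \<theta>" for \<theta>
    using D[of \<theta>] unfolding gderiv_def D_inner .
  then have grad: "gradient (\<lambda>\<eta>. cross_entropy (F \<eta>) c) = g"
    by (intro ext gradient_eqI)
  show "GDERIV (\<lambda>\<eta>. cross_entropy (F \<eta>) c) \<theta> :> gradient (\<lambda>\<eta>. cross_entropy (F \<eta>) c) \<theta>"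
    using g by (simp add: grad)
  have F'_comp: "(\<lambda>\<theta>. blinfun_apply (F' \<theta>) h $ j) differentiable (at \<theta>)" for h j \<theta>
    by (rule differentiableI[OF bounded_linear.has_derivative[OF bounded_linear_vec_nth
      bounded_linear.has_derivative[OF blinfun.bounded_linear_left F'']]])
  have "(\<lambda>\<theta>. exp (F \<theta> $ j)) differentiable (at \<theta>)" for j \<theta>
    by (rule differentiableI[OF has_derivative_exp[OF bounded_linear.has_derivative[OF bounded_linear_vec_nth F']]])
  moreover have "(\<Sum>j\<in>UNIV. exp (F \<theta> $ j)) \<noteq> 0" for \<theta>
    using sum_exp_pos[of "F \<theta>"] by simp
  ultimately have "(\<lambda>\<theta>. softmax (F \<theta>) $ j) differentiable (at \<theta>)" for j
    unfolding softmax_def by (simp add: differentiable_divide differentiable_sum)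
  then have "(\<lambda>\<theta>. D \<theta> h) differentiable (at \<theta>)" for h
    unfolding D_def by (intro differentiable_diff differentiable_sum ballI differentiable_mult F'_comp) auto
  then show "gradient (\<lambda>\<eta>. cross_entropy (F \<eta>) c) differentiable (at \<theta>)"
    unfolding grad g_def by (subst differentiable_componentwise_within) (auto simp: Basis_vec_def inner_axis)
qed

subsection \<open>The gradient flow\<close>

lemma lin_indep_family_drop_dependent:
  fixes d :: "('k::finite) option \<Rightarrow> 'a::euclidean_space"
  assumes rel: "(\<Sum>c\<in>UNIV. w c *\<^sub>R d c) = 0" and "w None \<noteq> 0"
    and S: "card S \<ge> CARD('k)" "lin_indep_family d S"
  shows "lin_indep_family (\<lambda>k. d (Some k)) UNIV"
proof -
  let ?R = "range (\<lambda>k. d (Some k))"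
  have d_None: "w None *\<^sub>R d None = - (\<Sum>k\<in>UNIV. w (Some k) *\<^sub>R d (Some k))"
    using rel by (simp add: UNIV_option_conv sum.reindex eq_neg_iff_add_eq_0)
  \<comment> \<open>The relation has nonzero weight at \<open>None\<close>, so the last vector lies
    in the span of the others. That span thus contains the independent family over \<open>S\<close>,
    and its dimension is the full \<open>CARD('k)\<close>.\<close>
  have "d None = (1 / w None) *\<^sub>R (w None *\<^sub>R d None)" using \<open>w None \<noteq> 0\<close> by simp
  also have "\<dots> \<in> span ?R"
    unfolding d_None
    by (intro span_scale span_neg span_sum) (auto intro: span_base)
  finally have "d c \<in> span ?R" for c
    by (cases c) (auto intro: span_base)
  then have "d ` S \<subseteq> span ?R" by blast
  then have "card (d ` S) \<le> dim (span ?R)"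
    using S(2) unfolding lin_indep_family_def by (intro independent_card_le_dim) auto
  then have dim: "CARD('k) \<le> dim (span ?R)"
    using S unfolding lin_indep_family_def by (simp add: card_image)
  have card: "card ?R \<le> CARD('k)" by (rule card_image_le) simp
  \<comment> \<open>A spanning set with no more elements than the dimension is independent; having
    exactly that many, it also has no repeated vectors.\<close>
  have "independent ?R"
    by (rule card_le_dim_spanning[of _ "span ?R"]) (use dim card in \<open>auto intro: span_base\<close>)
  moreover have "card ?R = CARD('k)"
    using dim card dim_le_card'[of ?R] by (simp add: dim_span)
  then have "inj (\<lambda>k. d (Some k))" by (intro eq_card_imp_inj_on) auto
  ultimately show ?thesis unfolding lin_indep_family_def by blast
qed

text \<open>A kernel vector \<open>w\<close> of the Gram matrix satisfies \<open>A^T w = 0\<close>,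
  a vanishing combination of the rows with coefficients \<open>w\<close>.\<close>

lemma invertible_gram_matrix:
  fixes A :: "real^'n^'m"
  assumes "lin_indep_family (\<lambda>k. A $ k) UNIV"
  shows "invertible (A ** transpose A)"
proof -
  have inj: "inj (\<lambda>k. A $ k)" and ind: "independent (range (\<lambda>k. A $ k))"
    using assms unfolding lin_indep_family_def by auto
  have "w = 0" if "(A ** transpose A) *v w = 0" for w
  proof -
    have "transpose A *v w = 0"
      using inner_gram_matrix[of w A w] that by simp
    then have "(\<Sum>k\<in>UNIV. w $ k *\<^sub>R A $ k) = 0"
      by (simp add: vec_eq_iff transpose_def matrix_vector_mult_def mult.commute)
    \<comment> \<open>Independence concerns the set of rows, so the sum is reindexed from row
      numbers to rows.\<close>
    then have "(\<Sum>v\<in>range (\<lambda>k. A $ k). w $ inv (\<lambda>k. A $ k) v *\<^sub>R v) = 0"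
      by (simp add: sum.reindex[OF inj] inv_f_f[OF inj])
    from independentD[OF ind _ subset_refl this] have "w $ inv (\<lambda>k. A $ k) (A $ k) = 0" for k
      by simp
    then show "w = 0" by (simp add: vec_eq_iff inv_f_f[OF inj])
  qed
  then show ?thesis
    by (simp add: invertible_left_inverse matrix_left_invertible_ker)
qed

lemma has_vector_derivative_vec:
  fixes f :: "'n::finite \<Rightarrow> real \<Rightarrow> 'a::euclidean_space"
  assumes "\<And>k. (f k has_vector_derivative f' k) (at t within I)"
  shows "((\<lambda>s. \<chi> k. f k s) has_vector_derivative (\<chi> k. f' k)) (at t within I)"
proof -
  have "((\<lambda>s. f k s \<bullet> b) has_derivative (\<lambda>s. s * (f' k \<bullet> b))) (at t within I)" for k b
    using has_derivative_inner_left[OF assms[unfolded has_vector_derivative_def], of k b] by simp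
  then show ?thesis
    unfolding has_vector_derivative_def
    by (subst has_derivative_componentwise_within) (auto simp: Basis_vec_def inner_axis)
qed

lemma norm_diff_squared_le:
  fixes a b :: "'a::real_inner"
  shows "(norm (a - b))\<^sup>2 \<le> 2 * (norm a)\<^sup>2 + 2 * (norm b)\<^sup>2"
proof -
  have "(norm (a - b))\<^sup>2 + (norm (a + b))\<^sup>2 = 2 * (norm a)\<^sup>2 + 2 * (norm b)\<^sup>2"
    by (simp add: power2_norm_eq_inner inner_diff_left inner_diff_right inner_add_left inner_add_right)
  then show ?thesis using zero_le_power2[of "norm (a + b)"] by linarith
qed

text \<open>A right neighbourhood of \<open>t\<close> stays inside the interval, even at
  \<open>t = 0\<close>; so one-sided derivatives there are unique.\<close>

lemma at_within_time_interval: "at t within time_interval T \<noteq> bot" if "t \<in> time_interval T"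
proof -
  have "0 \<le> t" "ereal t < T" using that by (auto simp: time_interval_def)
  then obtain b where b: "t < b" "ereal b < T" using ereal_dense2[of t T] by auto
  have "{t<..<b} \<subseteq> time_interval T"
  proof
    fix s assume "s \<in> {t<..<b}"
    then have "0 \<le> s" "ereal s < ereal b" using \<open>0 \<le> t\<close> by auto
    then show "s \<in> time_interval T" using order_less_trans[OF _ b(2)] by (simp add: time_interval_def)
  qed
  then show ?thesis
    using islimpt_greaterThanLessThan1[OF b(1)] islimpt_subset trivial_limit_within by blast
qed

lemma matrix_vector_mult_sum_left: "(\<Sum>i\<in>A. M i) *v v = (\<Sum>i\<in>A. M i *v v)" for M :: "'i \<Rightarrow> real^'a^'b"
  by (induction A rule: infinite_finite_induct) (simp_all add: matrix_vector_mult_add_rdistrib)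

section \<open>Class gradients and Hessians as functions of the parameter\<close>

locale smooth_classifier =
  fixes f :: "real^'p \<Rightarrow> real^'d \<Rightarrow> real^('k::finite option)"
    and x :: "nat \<Rightarrow> real^'d" and y :: "nat \<Rightarrow> 'k option" and n :: nat
  assumes C2: "twice_continuously_differentiable (\<lambda>\<eta>. f \<eta> u)"
    and nonempty: "card (class_indices y n c) \<ge> 1"
begin

lemma sample_loss_eq: "sample_loss f x y i = (\<lambda>\<eta>. cross_entropy (f \<eta> (x i)) (y i))"
  by (simp add: fun_eq_iff sample_loss_def)

lemma GDERIV_sample_loss: "GDERIV (sample_loss f x y i) \<theta> :> gradient (sample_loss f x y i) \<theta>"
  unfolding sample_loss_eq by (rule GDERIV_cross_entropy[OF C2])

lemma gradient_sample_loss_has_derivative: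
  "(gradient (sample_loss f x y i) has_derivative (\<lambda>h. hessian (sample_loss f x y i) \<theta> *v h)) (at \<theta>)"
  by (rule hessian_works) (unfold sample_loss_eq, rule differentiable_gradient_cross_entropy[OF C2])

text \<open>\<open>full_gradient\<close> is defined as the gradient of the averaged loss; linearity
  identifies it with the average of the sample gradients.\<close>

lemma full_gradient_eq:
  "full_gradient f x y n \<theta> = (1 / real n) *\<^sub>R (\<Sum>i=1..n. gradient (sample_loss f x y i) \<theta>)"
proof -
  have "((\<lambda>\<theta>. (1 / real n) * (\<Sum>i=1..n. sample_loss f x y i \<theta>)) has_derivative
     (\<lambda>h. (1 / real n) * (\<Sum>i=1..n. h \<bullet> gradient (sample_loss f x y i) \<theta>))) (at \<theta>)"
    using GDERIV_sample_loss unfolding gderiv_def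
    by (intro has_derivative_mult_right has_derivative_sum) blast
  then have "GDERIV (total_loss f x y n) \<theta> :>
      (1 / real n) *\<^sub>R (\<Sum>i=1..n. gradient (sample_loss f x y i) \<theta>)"
    by (simp add: gderiv_def total_loss_def[abs_def] inner_sum_right)
  then show ?thesis unfolding full_gradient_def by (rule gradient_eqI)
qed

lemma n_pos: "n > 0"
  using nonempty[of None] by (cases n) (auto simp: class_indices_def)

lemma sum_class_indices: "(\<Sum>c\<in>UNIV. \<Sum>i\<in>class_indices y n c. g i) = (\<Sum>i=1..n. g i)"
  unfolding class_indices_def by (rule sum.group) auto

text \<open>The weighted class gradients add up to \<open>n\<close> times the full gradient and the
  weights to \<open>n\<close>. This is the relation that allows the last class to be
  dropped.\<close>

lemma sum_gradient_deviation:
  "(\<Sum>c\<in>UNIV. real (card (class_indices y n c)) *\<^sub>R gradient_deviation f x y n c \<theta>) = 0"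
proof -
  have card: "card (class_indices y n c) \<noteq> 0" for c using nonempty[of c] by linarith
  have "(\<Sum>c\<in>UNIV. real (card (class_indices y n c)) *\<^sub>R class_gradient f x y n c \<theta>) =
      (\<Sum>i=1..n. gradient (sample_loss f x y i) \<theta>)"
    unfolding class_gradient_def by (simp add: card sum_class_indices)
  also have "\<dots> = real n *\<^sub>R full_gradient f x y n \<theta>"
    using n_pos by (simp add: full_gradient_eq)
  also have "real n = (\<Sum>c\<in>UNIV. real (card (class_indices y n c)))"
    using sum_class_indices[of "\<lambda>_. 1 :: real"] by simp
  finally show ?thesis
    by (simp add: gradient_deviation_def scaleR_diff_right sum_subtractf scaleR_sum_left)
qed

lemma full_gradient_has_derivative:
  "(full_gradient f x y n has_derivative (\<lambda>h. full_hessian f x y n \<theta> *v h)) (at \<theta>)"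
proof -
  have "full_gradient f x y n = (\<lambda>\<theta>. (1 / real n) *\<^sub>R (\<Sum>i=1..n. gradient (sample_loss f x y i) \<theta>))"
    by (rule ext) (rule full_gradient_eq)
  moreover have "\<dots> differentiable (at \<theta>)"
    by (rule differentiableI[OF has_derivative_scaleR_right[OF
      has_derivative_sum[OF gradient_sample_loss_has_derivative]]])
  ultimately have "gradient (total_loss f x y n) differentiable (at \<theta>)"
    by (simp add: full_gradient_def[abs_def])
  from hessian_works[OF this] show ?thesis
    by (simp add: full_gradient_def[abs_def] full_hessian_def)
qed

lemma class_gradient_has_derivative:
  "(class_gradient f x y n c has_derivative (\<lambda>h. class_hessian f x y n c \<theta> *v h)) (at \<theta>)"
proof -
  have "(class_gradient f x y n c has_derivative
      (\<lambda>h. (1 / real (card (class_indices y n c))) *\<^sub>R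
        (\<Sum>i\<in>class_indices y n c. hessian (sample_loss f x y i) \<theta> *v h))) (at \<theta>)"
    unfolding class_gradient_def[abs_def]
    by (intro has_derivative_scaleR_right has_derivative_sum gradient_sample_loss_has_derivative)
  then show ?thesis
    by (simp add: class_hessian_def matrix_vector_mult_sum_left flip: scaleR_matrix_vector_assoc)
qed

lemma gradient_deviation_has_derivative:
  "(gradient_deviation f x y n c has_derivative
     (\<lambda>h. (class_hessian f x y n c \<theta> - full_hessian f x y n \<theta>) *v h)) (at \<theta>)"
  unfolding gradient_deviation_def[abs_def] matrix_vector_mult_diff_rdistrib
  by (intro has_derivative_diff class_gradient_has_derivative full_gradient_has_derivative)

text \<open>Chain rule row by row, within \<open>I\<close> because the curve may have only a
  one-sided derivative.\<close>

lemma G_mat_along_curve: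
  assumes "(\<theta> has_vector_derivative v) (at t within I)"
  shows "((\<lambda>s. G_mat f x y n (\<theta> s)) has_vector_derivative
    (\<chi> k. (class_hessian f x y n (Some k) (\<theta> t) - full_hessian f x y n (\<theta> t)) *v v)) (at t within I)"
  unfolding G_mat_def
  using vector_derivative_diff_chain_within[OF assms
      has_derivative_at_withinI[OF gradient_deviation_has_derivative]]
  by (intro has_vector_derivative_vec) (simp add: o_def)

lemma invertible_G_mat_gram:
  assumes "card S \<ge> CARD('k)" "lin_indep_family (\<lambda>c. gradient_deviation f x y n c \<theta>) S"
  shows "invertible (G_mat f x y n \<theta> ** transpose (G_mat f x y n \<theta>))"
proof (rule invertible_gram_matrix)
  have "real (card (class_indices y n None)) \<noteq> 0" using nonempty[of None] by linarith
  then show "lin_indep_family (\<lambda>k. G_mat f x y n \<theta> $ k) UNIV"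
    using lin_indep_family_drop_dependent[OF sum_gradient_deviation _ assms] by (simp add: G_mat_def)
qed

end

text \<open>Differentiability of the projection is part of the conclusion, since
  \<open>vector_derivative\<close> means nothing at a point where it fails.\<close>

theorem theorem1:
  fixes f :: "real^'p \<Rightarrow> real^'d \<Rightarrow> real^('k::finite option)"
    and x :: "nat \<Rightarrow> real^'d"
    and y :: "nat \<Rightarrow> 'k option"
    and n :: nat
    and T :: ereal
    and \<theta> :: "real \<Rightarrow> real^'p"
  assumes model_C2: "\<And>u. twice_continuously_differentiable (\<lambda>\<eta>. f \<eta> u)"
    and classes_nonempty: "\<And>c. card (class_indices y n c) \<ge> 1"
    and T_pos: "0 < T"
    and flow: "gradient_flow_on (time_interval T) (total_loss f x y n) \<theta>"
    and indep: "\<And>t. t \<in> time_interval T \<Longrightarrow>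
      \<exists>S. card S \<ge> CARD('k option) - 1 \<and>
          lin_indep_family (\<lambda>c. gradient_deviation f x y n c (\<theta> t)) S"
  shows "\<forall>t \<in> time_interval T.
    (let P = (\<lambda>s. P_mat f x y n (\<theta> s));
         P' = vector_derivative P (at t within time_interval T);
         G = G_mat f x y n (\<theta> t);
         g = full_gradient f x y n (\<theta> t);
         H = full_hessian f x y n (\<theta> t);
         Hc = (\<lambda>c. class_hessian f x y n c (\<theta> t))
     in P differentiable (at t within time_interval T) \<and>
        (frobenius_norm P')\<^sup>2 \<le>
          4 / (sigma_min G)\<^sup>2 *
            (real (CARD('k option) - 1) * (norm ((mat 1 - P t) *v (H *v g)))\<^sup>2 +
             (\<Sum>k\<in>UNIV. (norm ((mat 1 - P t) *v (Hc (Some k) *v g)))\<^sup>2)))"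
proof (intro ballI)
  fix t assume t: "t \<in> time_interval T"
  interpret smooth_classifier f x y n
    using model_C2 classes_nonempty by unfold_locales
  let ?I = "time_interval T" and ?G = "\<lambda>s. G_mat f x y n (\<theta> s)" and ?P = "\<lambda>s. P_mat f x y n (\<theta> s)"
  define g where "g = full_gradient f x y n (\<theta> t)"
  define H where "H = full_hessian f x y n (\<theta> t)"
  define Hc where "Hc = (\<lambda>c. class_hessian f x y n c (\<theta> t))"
  define Q where "Q = mat 1 - ?P t"
  define G' where "G' = (\<chi> k. (Hc (Some k) - H) *v (- g))"
  have "(\<theta> has_vector_derivative - g) (at t within ?I)"
    using flow t unfolding gradient_flow_on_def g_def full_gradient_def by blast
  then have G': "(?G has_vector_derivative G') (at t within ?I)"
    unfolding G'_def Hc_def H_def by (rule G_mat_along_curve)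
  have inv: "invertible (?G s ** transpose (?G s))" if "s \<in> ?I" for s
    using indep[OF that] invertible_G_mat_gram by auto
  have diff: "?P differentiable (at t within ?I)"
    unfolding P_mat_def Let_def
    by (rule projection_derivative_bound(1)[OF t at_within_time_interval[OF t] inv G'])
  have bound: "(norm (vector_derivative ?P (at t within ?I)))\<^sup>2 \<le>
      2 / (sigma_min (?G t))\<^sup>2 * (\<Sum>k\<in>UNIV. (norm (Q *v (G' $ k)))\<^sup>2)"
    unfolding Q_def P_mat_def Let_def
    by (rule projection_derivative_bound[OF t at_within_time_interval[OF t] inv G'])
  have "(norm (Q *v (G' $ k)))\<^sup>2 \<le> 2 * (norm (Q *v (H *v g)))\<^sup>2 + 2 * (norm (Q *v (Hc (Some k) *v g)))\<^sup>2"
    for k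
  proof -
    \<comment> \<open>The velocity \<open>- g\<close> of the flow reverses the order of the
      difference.\<close>
    have "Q *v (G' $ k) = Q *v (H *v g) - Q *v (Hc (Some k) *v g)"
      unfolding G'_def
      by (simp add: matrix_vector_mult_diff_rdistrib matrix_vector_mult_diff_distrib
          linear_neg[OF matrix_vector_mul_linear])
    then show ?thesis using norm_diff_squared_le by metis
  qed
  then have "(\<Sum>k\<in>UNIV. (norm (Q *v (G' $ k)))\<^sup>2) \<le>
      (\<Sum>k\<in>UNIV. 2 * (norm (Q *v (H *v g)))\<^sup>2 + 2 * (norm (Q *v (Hc (Some k) *v g)))\<^sup>2)"
    by (rule sum_mono)
  \<comment> \<open>The first term does not depend on the class, so it is counted
    \<open>CARD('k) = C - 1\<close> times. The 2 pulled out here meets the 2 of the projection bound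
    to give the final 4.\<close>
  also have "\<dots> = 2 * (real CARD('k) * (norm (Q *v (H *v g)))\<^sup>2 +
      (\<Sum>k\<in>UNIV. (norm (Q *v (Hc (Some k) *v g)))\<^sup>2))"
    by (simp add: sum.distrib sum_distrib_left)
  finally have "2 / (sigma_min (?G t))\<^sup>2 * (\<Sum>k\<in>UNIV. (norm (Q *v (G' $ k)))\<^sup>2) \<le>
      2 / (sigma_min (?G t))\<^sup>2 * (2 * (real CARD('k) * (norm (Q *v (H *v g)))\<^sup>2 +
        (\<Sum>k\<in>UNIV. (norm (Q *v (Hc (Some k) *v g)))\<^sup>2)))"
    by (rule mult_left_mono) simp
  then have "(norm (vector_derivative ?P (at t within ?I)))\<^sup>2 \<le>
      4 / (sigma_min (?G t))\<^sup>2 * (real (CARD('k option) - 1) * (norm (Q *v (H *v g)))\<^sup>2 +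
        (\<Sum>k\<in>UNIV. (norm (Q *v (Hc (Some k) *v g)))\<^sup>2))"
    using bound by (simp add: Q_def)
  then show "let P = ?P;
         P' = vector_derivative P (at t within ?I);
         G = G_mat f x y n (\<theta> t);
         g = full_gradient f x y n (\<theta> t);
         H = full_hessian f x y n (\<theta> t);
         Hc = (\<lambda>c. class_hessian f x y n c (\<theta> t))
     in P differentiable (at t within ?I) \<and>
        (frobenius_norm P')\<^sup>2 \<le>
          4 / (sigma_min G)\<^sup>2 *
            (real (CARD('k option) - 1) * (norm ((mat 1 - P t) *v (H *v g)))\<^sup>2 +
             (\<Sum>k\<in>UNIV. (norm ((mat 1 - P t) *v (Hc (Some k) *v g)))\<^sup>2))"
    unfolding Let_def frobenius_norm_eq_norm Q_def H_def Hc_def g_def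
    using diff by blast
qed

end
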